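(* Let $\varphi_1:\mathbb R^p\to\mathbb R$ be differentiable with $L$-Lipschitz gradient, let $\varphi_2:\mathbb R^p\to\mathbb R\cup\{\infty\}$ be proper and lower semicontinuous, and suppose that $\varphi=\varphi_1+\varphi_2$ satisfies $\operatorname{argmin}\varphi\ne\emptyset$. For any $0<\gamma<1/L$ the following hold: (i) $\inf\varphi=\inf\varphi_\gamma^{\rm dr}$; (ii) $\operatorname{argmin}\varphi=\operatorname{prox}_{\gamma\varphi_1}(\operatorname{argmin}\varphi_\gamma^{\rm dr})$; (iii) $\varphi$ is level bounded if and only if $\varphi_\gamma^{\rm dr}$ is level bounded.
   Context: Convention $1/0=\infty$. $\operatorname{prox}_{\gamma h}(x)=\operatorname{argmin}_w\{h(w)+\frac1{2\gamma}\|w-x\|^2\}$; for $\gamma<1/L$, $\operatorname{prox}_{\gamma\varphi_1}$ is single valued. Douglas-Rachford envelope $\varphi_\gamma^{\rm dr}:\mathbb R^p\to\mathbb R$: with $u=\operatorname{prox}_{\gamma\varphi_1}(s)$, $$\varphi_\gamma^{\rm dr}(s)=\min_{w\in\mathbb R^p}\{\varphi_2(w)+\varphi_1(u)+\langle\nabla\varphi_1(u),w-u\rangle+\tfrac1{2\gamma}\|w-u\|^2\}.$$ A function $h$ is level bounded if $\{x:h(x)\le\alpha\}$ is bounded for all $\alpha\in\mathbb R$. *)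

theory Defs
  imports "HOL-Analysis.Analysis"
begin

definition grad :: "('a::real_inner \<Rightarrow> real) \<Rightarrow> 'a \<Rightarrow> 'a"
  where "grad f x = (THE D. GDERIV f x :> D)"

definition proper :: "('a \<Rightarrow> ereal) \<Rightarrow> bool"
  where "proper h \<longleftrightarrow> (\<forall>x. h x \<noteq> -\<infinity>) \<and> (\<exists>x. h x \<noteq> \<infinity>)"

definition lower_semicontinuous :: "('a::topological_space \<Rightarrow> ereal) \<Rightarrow> bool"
  where "lower_semicontinuous h \<longleftrightarrow> (\<forall>x. h x \<le> Liminf (at x) h)"

definition argmin :: "('a \<Rightarrow> 'b::linorder) \<Rightarrow> 'a set"
  where "argmin h = {x. is_arg_min h (\<lambda>_. True) x}"

definition level_bounded :: "('a::metric_space \<Rightarrow> ereal) \<Rightarrow> bool"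
  where "level_bounded h \<longleftrightarrow> (\<forall>\<alpha>::real. bounded {x. h x \<le> ereal \<alpha>})"

definition prox :: "real \<Rightarrow> ('a::real_normed_vector \<Rightarrow> ereal) \<Rightarrow> 'a \<Rightarrow> 'a set"
  where "prox \<gamma> h x = argmin (\<lambda>w. h w + ereal (1 / (2 * \<gamma>) * (norm (w - x))\<^sup>2))"

text \<open>
  The minimum over \<open>w\<close> is written as an infimum in \<^typ>\<open>ereal\<close>, and \<open>u\<close> as the element of a
  singleton.  Under the standing assumptions on \<open>\<phi>\<^sub>1\<close>, \<open>\<phi>\<^sub>2\<close>, \<open>\<gamma>\<close> these are the intended objects:
  the lemmas \<open>prox_singleton\<close> and \<open>dre_attained\<close> below show that the proximal set is a singleton
  and that the infimum is an attained, real value.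
\<close>

definition dre_model ::
    "real \<Rightarrow> ('a::real_inner \<Rightarrow> real) \<Rightarrow> ('a \<Rightarrow> ereal) \<Rightarrow> 'a \<Rightarrow> 'a \<Rightarrow> ereal"
  where "dre_model \<gamma> \<phi>\<^sub>1 \<phi>\<^sub>2 u w =
    \<phi>\<^sub>2 w + ereal (\<phi>\<^sub>1 u + inner (grad \<phi>\<^sub>1 u) (w - u) + 1 / (2 * \<gamma>) * (norm (w - u))\<^sup>2)"

definition dre :: "real \<Rightarrow> ('a::real_inner \<Rightarrow> real) \<Rightarrow> ('a \<Rightarrow> ereal) \<Rightarrow> 'a \<Rightarrow> ereal"
  where "dre \<gamma> \<phi>\<^sub>1 \<phi>\<^sub>2 s =
    (let u = the_elem (prox \<gamma> (\<lambda>x. ereal (\<phi>\<^sub>1 x)) s) in INF w. dre_model \<gamma> \<phi>\<^sub>1 \<phi>\<^sub>2 u w)"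

lemma GDERIV_grad:
  fixes f :: "'a::euclidean_space \<Rightarrow> real"
  assumes "f differentiable (at x)"
  shows "GDERIV f x :> grad f x"
proof -
  obtain D where D: "(f has_derivative D) (at x)"
    using assms by (auto simp: differentiable_def)
  have "D h = inner h (adjoint D 1)" for h
    using adjoint_works[OF has_derivative_linear[OF D], of h 1] by simp
  then have ex: "GDERIV f x :> adjoint D 1"
    using D unfolding gderiv_def by (metis ext)
  have "E = adjoint D 1" if "GDERIV f x :> E" for E
  proof -
    have "(\<lambda>h. inner h E) = (\<lambda>h. inner h (adjoint D 1))"
      using that ex has_derivative_unique unfolding gderiv_def by blast
    then have "inner h E = inner h (adjoint D 1)" for h by meson
    then show ?thesis by (metis vector_eq_rdot inner_commute)
  qed
  then show ?thesis
    unfolding grad_def using ex by (metis theI)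
qed

lemma lipschitz_grad_bound:
  fixes f :: "'a::euclidean_space \<Rightarrow> real"
  assumes diff: "\<And>x. f differentiable (at x)" and lip: "L-lipschitz_on UNIV (grad f)"
  shows "\<bar>f w - (f v + inner (grad f v) (w - v))\<bar> \<le> L / 2 * (norm (w - v))\<^sup>2"
proof -
  define d where "d = w - v"
  define k where "k e t = e * (f (v + t *\<^sub>R d) - t * inner d (grad f v)) + L / 2 * t\<^sup>2 * (norm d)\<^sup>2" for e t
  define k' where "k' e t = e * (inner d (grad f (v + t *\<^sub>R d)) - inner d (grad f v)) + L * t * (norm d)\<^sup>2" for e t
  have der: "(k e has_real_derivative k' e t) (at t)" for e t
  proof -
    have fd: "(f has_derivative (\<lambda>h. inner h (grad f (v + t *\<^sub>R d)))) (at (v + t *\<^sub>R d))"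
      using GDERIV_grad[OF diff] by (simp add: gderiv_def)
    have "((\<lambda>t. v + t *\<^sub>R d) has_derivative (\<lambda>h. h *\<^sub>R d)) (at t)"
      by (auto intro!: derivative_eq_intros)
    from has_derivative_compose[OF this fd]
    have "((\<lambda>t. f (v + t *\<^sub>R d)) has_real_derivative inner d (grad f (v + t *\<^sub>R d))) (at t)"
      by (simp add: has_field_derivative_def mult_commute_abs)
    then show ?thesis
      unfolding k_def[abs_def] k'_def by (auto intro!: derivative_eq_intros)
  qed
  have pos: "0 \<le> k' e t" if "0 \<le> t" "e = 1 \<or> e = -1" for e t
  proof -
    have "\<bar>inner d (grad f (v + t *\<^sub>R d) - grad f v)\<bar> \<le> norm d * norm (grad f (v + t *\<^sub>R d) - grad f v)"
      by (rule Cauchy_Schwarz_ineq2)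
    also have "\<dots> \<le> norm d * (L * (t * norm d))"
      using lipschitz_onD[OF lip, of "v + t *\<^sub>R d" v] that
      by (intro mult_left_mono) (auto simp: dist_norm)
    finally show ?thesis
      using that(2) by (auto simp add: k'_def inner_diff_right power2_eq_square algebra_simps)
  qed
  have "k e 0 \<le> k e 1" if "e = 1 \<or> e = -1" for e
    using DERIV_nonneg_imp_nondecreasing[of 0 1 "k e"] der[of e] pos[OF _ that] zero_le_one by blast
  from this[of 1] this[of "-1"] show ?thesis
    unfolding abs_le_iff by (simp add: k_def d_def inner_commute)
qed

lemma prox_singleton:
  fixes \<phi>\<^sub>1 :: "'a::euclidean_space \<Rightarrow> real"
  assumes diff: "\<And>x. \<phi>\<^sub>1 differentiable (at x)" and lip: "L-lipschitz_on UNIV (grad \<phi>\<^sub>1)"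
    and "0 < \<gamma>" "ereal \<gamma> < 1 / ereal L"
  shows "\<exists>u. prox \<gamma> (\<lambda>x. ereal (\<phi>\<^sub>1 x)) s = {u}"
proof -
  have L0: "0 \<le> L" using lip by (rule lipschitz_on_nonneg)
  have gL: "\<gamma> * L < 1"
    using assms(3,4) L0 by (cases "L = 0") (auto simp: one_ereal_def field_simps)
  have "\<exists>!v. s - \<gamma> *\<^sub>R grad \<phi>\<^sub>1 v = v"
  proof (rule banach_fix_type[of "\<gamma> * L"], goal_cases)
    case 3
    have "dist (s - \<gamma> *\<^sub>R grad \<phi>\<^sub>1 x) (s - \<gamma> *\<^sub>R grad \<phi>\<^sub>1 y) \<le> \<gamma> * L * dist x y" for x y
    proof -
    have "dist (s - \<gamma> *\<^sub>R grad \<phi>\<^sub>1 x) (s - \<gamma> *\<^sub>R grad \<phi>\<^sub>1 y) = \<gamma> * dist (grad \<phi>\<^sub>1 x) (grad \<phi>\<^sub>1 y)"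
      using \<open>0 < \<gamma>\<close> by (simp add: dist_norm norm_minus_commute flip: scaleR_diff_right)
    also have "\<dots> \<le> \<gamma> * (L * dist x y)"
      using lipschitz_onD[OF lip] \<open>0 < \<gamma>\<close> by simp
    finally show ?thesis by (simp add: mult.assoc)
    qed
    then show ?case by blast
  qed (use gL L0 \<open>0 < \<gamma>\<close> in auto)
  then obtain v where v: "s - \<gamma> *\<^sub>R grad \<phi>\<^sub>1 v = v" by auto
  define P where "P w = \<phi>\<^sub>1 w + 1 / (2 * \<gamma>) * (norm (w - s))\<^sup>2" for w
  have quad: "(1 / \<gamma> - L) / 2 * x = 1 / (2 * \<gamma>) * x - L / 2 * x" for x
    by (simp add: left_diff_distrib diff_divide_distrib)
  have P: "P v + (1 / \<gamma> - L) / 2 * (norm (w - v))\<^sup>2 \<le> P w" for w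
  proof -
    have ws: "w - s = (w - v) - \<gamma> *\<^sub>R grad \<phi>\<^sub>1 v" and vs: "v - s = - (\<gamma> *\<^sub>R grad \<phi>\<^sub>1 v)"
      using v by (auto simp: algebra_simps)
    have "(norm (e - \<gamma> *\<^sub>R g))\<^sup>2 = (norm e)\<^sup>2 - 2 * \<gamma> * inner g e + (norm (- (\<gamma> *\<^sub>R g)))\<^sup>2" for e g :: 'a
      unfolding power2_norm_eq_inner by (simp add: inner_diff_left inner_diff_right inner_commute)
    from this[of "w - v" "grad \<phi>\<^sub>1 v"]
    have "(norm (w - s))\<^sup>2 = (norm (w - v))\<^sup>2 - 2 * \<gamma> * inner (grad \<phi>\<^sub>1 v) (w - v) + (norm (v - s))\<^sup>2"
      by (simp only: ws vs)
    then have "1 / (2 * \<gamma>) * (norm (w - s))\<^sup>2 =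
        1 / (2 * \<gamma>) * (norm (w - v))\<^sup>2 - inner (grad \<phi>\<^sub>1 v) (w - v) + 1 / (2 * \<gamma>) * (norm (v - s))\<^sup>2"
      using \<open>0 < \<gamma>\<close> by (simp add: field_simps)
    then show ?thesis
      using lipschitz_grad_bound[OF diff lip, where v = v and w = w]
      unfolding abs_le_iff P_def quad by linarith
  qed
  have pos: "0 < (1 / \<gamma> - L) / 2"
    using gL \<open>0 < \<gamma>\<close> by (simp add: field_simps)
  have min: "P v < P w" if "w \<noteq> v" for w
  proof -
    have "0 < (1 / \<gamma> - L) / 2 * (norm (w - v))\<^sup>2"
      using pos that by (intro mult_pos_pos) auto
    then show ?thesis using P[of w] by linarith
  qed
  have "is_arg_min (\<lambda>w. ereal (P w)) (\<lambda>_. True) x \<longleftrightarrow> x = v" for x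
    unfolding is_arg_min_linorder using min
    by (metis ereal_less_eq(3) less_imp_le not_le order_refl)
  then have "prox \<gamma> (\<lambda>x. ereal (\<phi>\<^sub>1 x)) s = {v}"
    by (simp add: prox_def argmin_def P_def)
  then show ?thesis ..
qed

lemma lsc_coercive_attains:
  fixes h :: "'a::euclidean_space \<Rightarrow> ereal" and q :: "'a \<Rightarrow> real"
  assumes lsc: "lower_semicontinuous h" and q: "continuous_on UNIV q"
    and low: "\<And>w. ereal c + ereal (a * (norm (w - u))\<^sup>2) \<le> h w + ereal (q w)" and "0 < a"
    and fin: "h w0 \<noteq> \<infinity>"
  shows "\<exists>w. (INF w. h w + ereal (q w)) = h w + ereal (q w) \<and> \<bar>h w + ereal (q w)\<bar> \<noteq> \<infinity>"
proof -
  define F where "F w = h w + ereal (q w)" for w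
  have hm: "h w \<noteq> -\<infinity>" for w using low[of w] by auto
  define m where "m = (INF w. F w)"
  have cm: "ereal c \<le> m"
    unfolding m_def
  proof (rule INF_greatest)
    fix w
    have "ereal c \<le> ereal c + ereal (a * (norm (w - u))\<^sup>2)" using \<open>0 < a\<close> by simp
    then show "ereal c \<le> F w" using low[of w] unfolding F_def by (rule order_trans)
  qed
  have "m \<le> F w0" unfolding m_def by (rule INF_lower) simp
  moreover have "F w0 < \<infinity>" using fin hm[of w0] by (cases "h w0") (auto simp: F_def)
  ultimately obtain mr where mr: "m = ereal mr" using cm by (cases m) auto
  have opn: "open {x. ereal r < F x}" for r
  proof (subst open_subopen, clarify)
    fix x assume x: "ereal r < F x"
    then have "ereal (r - q x) < h x" using hm[of x] by (cases "h x") (auto simp: F_def)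
    then obtain t where t: "ereal (r - q x) < ereal t" "ereal t < h x"
      using ereal_dense2 by blast
    have "h x \<le> Liminf (at x) h" using lsc by (simp add: lower_semicontinuous_def)
    then have "eventually (\<lambda>y. ereal t < h y) (at x)"
      using t(2) unfolding le_Liminf_iff by blast
    then have 1: "eventually (\<lambda>y. ereal t < h y) (nhds x)"
      using t(2) by (auto simp: eventually_nhds_conv_at)
    have "(q \<longlongrightarrow> q x) (nhds x)"
      using q by (simp add: continuous_on_eq_continuous_at isCont_def tendsto_at_iff_tendsto_nhds)
    then have 2: "eventually (\<lambda>y. r - t < q y) (nhds x)"
      using t(1) by (intro order_tendstoD) auto
    have "eventually (\<lambda>y. ereal r < F y) (nhds x)"
      using 1 2
    proof eventually_elim
      case (elim y)
      then show ?case by (cases "h y") (auto simp: F_def)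
    qed
    then show "\<exists>T. open T \<and> x \<in> T \<and> T \<subseteq> {x. ereal r < F x}"
      by (auto simp: eventually_nhds)
  qed
  have "\<exists>w. F w \<le> m"
  proof (rule ccontr)
    assume "\<not> ?thesis"
    then have gt: "m < F w" for w by (simp add: not_le)
    define R where "R = sqrt (max 0 ((mr + 1 - c) / a))"
    have cov: "cball u R \<subseteq> (\<Union>r\<in>{mr<..}. {x. ereal r < F x})"
    proof
      fix x
      obtain r where "m < ereal r" "ereal r < F x" using gt[of x] ereal_dense2 by blast
      then show "x \<in> (\<Union>r\<in>{mr<..}. {x. ereal r < F x})" using mr by auto
    qed
    obtain C where C: "C \<subseteq> {mr<..}" "finite C" "cball u R \<subseteq> (\<Union>r\<in>C. {x. ereal r < F x})"
      by (rule compactE_image[OF compact_cball _ cov]) (use opn in auto)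
    define r where "r = Min (insert (mr + 1) C)"
    have r: "mr < r" unfolding r_def using C by auto
    have "ereal r \<le> F w" for w
    proof (cases "w \<in> cball u R")
      case True
      then obtain b where "b \<in> C" "ereal b < F w" using C(3) by auto
      moreover have "r \<le> b" unfolding r_def using \<open>b \<in> C\<close> C(2) by simp
      ultimately show ?thesis by (meson ereal_less_eq(3) less_imp_le order_trans)
    next
      case False
      then have "R < norm (w - u)" by (simp add: dist_norm norm_minus_commute)
      moreover have "0 \<le> R" by (simp add: R_def)
      ultimately have "R\<^sup>2 \<le> (norm (w - u))\<^sup>2" by (intro power_mono) auto
      then have "(mr + 1 - c) / a \<le> (norm (w - u))\<^sup>2" by (simp add: R_def)
      then have "mr + 1 \<le> c + a * (norm (w - u))\<^sup>2" using \<open>0 < a\<close> by (simp add: field_simps)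
      moreover have "r \<le> mr + 1" unfolding r_def using C(2) by simp
      ultimately have "ereal r \<le> ereal c + ereal (a * (norm (w - u))\<^sup>2)" by simp
      then show ?thesis using low[of w] unfolding F_def by (rule order_trans)
    qed
    then have "ereal r \<le> m" unfolding m_def by (intro INF_greatest) auto
    then show False using r mr by simp
  qed
  then obtain w where "F w \<le> m" by blast
  then have "F w = m" by (metis INF_lower UNIV_I antisym m_def)
  then show ?thesis using mr by (intro exI[of _ w]) (simp add: F_def m_def)
qed

lemma dre_attained:
  fixes \<phi>\<^sub>1 :: "'a::euclidean_space \<Rightarrow> real" and \<phi>\<^sub>2 :: "'a \<Rightarrow> ereal"
  assumes diff: "\<And>x. \<phi>\<^sub>1 differentiable (at x)" and lip: "L-lipschitz_on UNIV (grad \<phi>\<^sub>1)"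
    and "proper \<phi>\<^sub>2" and lsc: "lower_semicontinuous \<phi>\<^sub>2"
    and ne: "argmin (\<lambda>x. ereal (\<phi>\<^sub>1 x) + \<phi>\<^sub>2 x) \<noteq> {}"
    and "0 < \<gamma>" "ereal \<gamma> < 1 / ereal L"
    and u: "u = the_elem (prox \<gamma> (\<lambda>x. ereal (\<phi>\<^sub>1 x)) s)"
  shows "\<exists>w \<in> argmin (dre_model \<gamma> \<phi>\<^sub>1 \<phi>\<^sub>2 u).
    dre \<gamma> \<phi>\<^sub>1 \<phi>\<^sub>2 s = dre_model \<gamma> \<phi>\<^sub>1 \<phi>\<^sub>2 u w \<and> \<bar>dre \<gamma> \<phi>\<^sub>1 \<phi>\<^sub>2 s\<bar> \<noteq> \<infinity>"
proof -
  have L0: "0 \<le> L" using lip by (rule lipschitz_on_nonneg)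
  have "\<gamma> * L < 1"
    using assms(6,7) L0 by (cases "L = 0") (auto simp: one_ereal_def field_simps)
  then have a: "0 < (1 / \<gamma> - L) / 2" using \<open>0 < \<gamma>\<close> by (simp add: field_simps)
  define q where "q w = \<phi>\<^sub>1 u + inner (grad \<phi>\<^sub>1 u) (w - u) + 1 / (2 * \<gamma>) * (norm (w - u))\<^sup>2" for w
  obtain z where z: "\<And>y. ereal (\<phi>\<^sub>1 z) + \<phi>\<^sub>2 z \<le> ereal (\<phi>\<^sub>1 y) + \<phi>\<^sub>2 y"
    using ne by (auto simp: argmin_def is_arg_min_linorder)
  obtain w0 where w0: "\<phi>\<^sub>2 w0 \<noteq> \<infinity>" and np: "\<And>x. \<phi>\<^sub>2 x \<noteq> -\<infinity>"
    using \<open>proper \<phi>\<^sub>2\<close> by (auto simp: proper_def)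
  obtain c where c: "\<phi>\<^sub>2 z = ereal c"
    using z[of w0] w0 np[of w0] np[of z] by (cases "\<phi>\<^sub>2 z"; cases "\<phi>\<^sub>2 w0") auto
  have quad: "(1 / \<gamma> - L) / 2 * x = 1 / (2 * \<gamma>) * x - L / 2 * x" for x
    by (simp add: left_diff_distrib diff_divide_distrib)
  have low: "ereal (\<phi>\<^sub>1 z + c) + ereal ((1 / \<gamma> - L) / 2 * (norm (w - u))\<^sup>2) \<le> \<phi>\<^sub>2 w + ereal (q w)" for w
  proof (cases "\<phi>\<^sub>2 w")
    case (real b)
    have "\<phi>\<^sub>1 z + c \<le> \<phi>\<^sub>1 w + b" using z[of w] real c by simp
    moreover have "\<phi>\<^sub>1 w + (1 / \<gamma> - L) / 2 * (norm (w - u))\<^sup>2 \<le> q w"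
      using lipschitz_grad_bound[OF diff lip, where v = u and w = w]
      unfolding abs_le_iff q_def quad by linarith
    ultimately have "\<phi>\<^sub>1 z + c + (1 / \<gamma> - L) / 2 * (norm (w - u))\<^sup>2 \<le> b + q w"
      by linarith
    then show ?thesis
      unfolding real plus_ereal.simps ereal_less_eq .
  qed (use np[of w] in auto)
  have "continuous_on UNIV q" unfolding q_def by (intro continuous_intros)
  then have "\<exists>w. (INF w. \<phi>\<^sub>2 w + ereal (q w)) = \<phi>\<^sub>2 w + ereal (q w) \<and> \<bar>\<phi>\<^sub>2 w + ereal (q w)\<bar> \<noteq> \<infinity>"
    by (rule lsc_coercive_attains[OF lsc _ low a w0])
  then obtain w where
    w: "(INF w. \<phi>\<^sub>2 w + ereal (q w)) = \<phi>\<^sub>2 w + ereal (q w)" "\<bar>\<phi>\<^sub>2 w + ereal (q w)\<bar> \<noteq> \<infinity>"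
    by (elim exE conjE)
  have m: "dre_model \<gamma> \<phi>\<^sub>1 \<phi>\<^sub>2 u = (\<lambda>w. \<phi>\<^sub>2 w + ereal (q w))"
    by (simp add: dre_model_def q_def fun_eq_iff)
  have d: "dre \<gamma> \<phi>\<^sub>1 \<phi>\<^sub>2 s = (INF w. \<phi>\<^sub>2 w + ereal (q w))"
    by (simp add: dre_def m flip: u)
  have "\<phi>\<^sub>2 w + ereal (q w) \<le> \<phi>\<^sub>2 y + ereal (q y)" for y
    unfolding w(1)[symmetric] by (rule INF_lower) simp
  then have "w \<in> argmin (dre_model \<gamma> \<phi>\<^sub>1 \<phi>\<^sub>2 u)"
    by (simp add: argmin_def is_arg_min_linorder m)
  then show ?thesis using w d m by (intro bexI[of _ w]) auto
qed

end

theory Submission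
  imports Defs
begin

text \<open>
  The envelope is best studied in the variable \<open>u = prox s\<close> instead of \<open>s\<close>.  By Fermat's rule
  \<open>u \<in> prox s\<close> forces \<open>s = u + \<gamma> \<nabla>\<phi>\<^sub>1(u)\<close>, and since \<open>\<gamma> L < 1\<close> the map \<open>u \<mapsto> u + \<gamma> \<nabla>\<phi>\<^sub>1(u)\<close> distorts
  distances by a factor between \<open>1 - \<gamma> L > 0\<close> and \<open>1 + \<gamma> L\<close>.  As the proximal set is a singleton
  for every \<open>s\<close>, this map is a bi-Lipschitz bijection whose inverse is the proximal map
  (\<open>prox1_grad_step\<close>, \<open>surj_grad_step\<close>), and so infima, minimisers and bounded sets
  (\<open>bounded_grad_step_image_iff\<close>) may be transported freely between \<open>s\<close> and \<open>u\<close>.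

  In the variable \<open>u\<close> the envelope is squeezed by the objective \<open>\<phi> = \<phi>\<^sub>1 + \<phi>\<^sub>2\<close>:
  \<open>\<phi>(w) + (1/2)(1/\<gamma> - L) \<parallel>w - u\<parallel>\<^sup>2 \<le> dre(s) \<le> \<phi>(u)\<close>, where \<open>w\<close> minimises the model at \<open>u\<close>
  (\<open>objective_le_envelope\<close>, \<open>envelope_le_objective\<close>).  The upper bound takes \<open>w = u\<close> in the model;
  the lower bound is the quadratic error estimate for the linearisation of \<open>\<phi>\<^sub>1\<close> at \<open>u\<close>.  Equality of the
  infima is immediate.  If \<open>s\<close> minimises the envelope, the quadratic term must vanish, so \<open>w = u\<close>
  is a minimiser of \<open>\<phi>\<close>.  On a sublevel set of the envelope the quadratic term is bounded because \<open>\<phi>\<close>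
  is bounded below, so \<open>u\<close> stays at bounded distance from a sublevel set of \<open>\<phi>\<close>; the upper
  bound gives the converse implication.
\<close>

locale dr_splitting =
  fixes \<phi>\<^sub>1 :: "'a::euclidean_space \<Rightarrow> real" and \<phi>\<^sub>2 :: "'a \<Rightarrow> ereal" and L \<gamma> :: real
  assumes diff: "\<And>x. \<phi>\<^sub>1 differentiable (at x)"
    and lip: "L-lipschitz_on UNIV (grad \<phi>\<^sub>1)"
    and proper: "proper \<phi>\<^sub>2"
    and lsc: "lower_semicontinuous \<phi>\<^sub>2"
    and argmin_nonempty: "argmin (\<lambda>x. ereal (\<phi>\<^sub>1 x) + \<phi>\<^sub>2 x) \<noteq> {}"
    and \<gamma>_pos: "0 < \<gamma>" and \<gamma>_less: "ereal \<gamma> < 1 / ereal L"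
begin

abbreviation objective :: "'a \<Rightarrow> ereal"
  where "objective x \<equiv> ereal (\<phi>\<^sub>1 x) + \<phi>\<^sub>2 x"

abbreviation prox1 :: "'a \<Rightarrow> 'a set"
  where "prox1 \<equiv> prox \<gamma> (\<lambda>x. ereal (\<phi>\<^sub>1 x))"

abbreviation envelope :: "'a \<Rightarrow> ereal"
  where "envelope \<equiv> dre \<gamma> \<phi>\<^sub>1 \<phi>\<^sub>2"

definition grad_step :: "'a \<Rightarrow> 'a"
  where "grad_step u = u + \<gamma> *\<^sub>R grad \<phi>\<^sub>1 u"

text \<open>
  The function \<open>w \<mapsto> \<phi>\<^sub>1(w) + (1 / (2\<gamma>)) \<parallel>w - s\<parallel>\<^sup>2\<close> is strongly convex with constant \<open>1 / \<gamma> - L\<close>.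
  Half of this constant is what survives of \<open>1 / (2\<gamma>)\<close> after the error \<open>L / 2\<close> of linearising \<open>\<phi>\<^sub>1\<close>.
\<close>

definition modulus :: real
  where "modulus = (1 / \<gamma> - L) / 2"

lemma gamma_L_less_1: "\<gamma> * L < 1"
  using \<gamma>_pos \<gamma>_less lipschitz_on_nonneg[OF lip]
  by (cases "L = 0") (auto simp: one_ereal_def field_simps)

lemma modulus_pos: "0 < modulus"
  using gamma_L_less_1 \<gamma>_pos by (simp add: modulus_def field_simps)

section \<open>The gradient step inverts the proximal map\<close>

lemma grad_step_perturbation:
  "norm (\<gamma> *\<^sub>R grad \<phi>\<^sub>1 x - \<gamma> *\<^sub>R grad \<phi>\<^sub>1 y) \<le> \<gamma> * L * norm (x - y)"
proof -
  have "norm (\<gamma> *\<^sub>R grad \<phi>\<^sub>1 x - \<gamma> *\<^sub>R grad \<phi>\<^sub>1 y) = \<gamma> * dist (grad \<phi>\<^sub>1 x) (grad \<phi>\<^sub>1 y)"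
    using \<gamma>_pos by (simp add: dist_norm flip: scaleR_diff_right)
  also have "\<dots> \<le> \<gamma> * (L * dist x y)"
    using lipschitz_onD[OF lip] \<gamma>_pos by simp
  finally show ?thesis by (simp add: dist_norm mult.assoc)
qed

lemma grad_step_upper: "norm (grad_step x - grad_step y) \<le> (1 + \<gamma> * L) * norm (x - y)"
proof -
  have "grad_step x - grad_step y = (x - y) + (\<gamma> *\<^sub>R grad \<phi>\<^sub>1 x - \<gamma> *\<^sub>R grad \<phi>\<^sub>1 y)"
    by (simp add: grad_step_def)
  then show ?thesis
    using grad_step_perturbation[of x y]
      norm_triangle_ineq[of "x - y" "\<gamma> *\<^sub>R grad \<phi>\<^sub>1 x - \<gamma> *\<^sub>R grad \<phi>\<^sub>1 y"]
    by (simp add: distrib_right)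
qed

lemma grad_step_lower: "(1 - \<gamma> * L) * norm (x - y) \<le> norm (grad_step x - grad_step y)"
proof -
  have "x - y = (grad_step x - grad_step y) - (\<gamma> *\<^sub>R grad \<phi>\<^sub>1 x - \<gamma> *\<^sub>R grad \<phi>\<^sub>1 y)"
    by (simp add: grad_step_def)
  then have "norm (x - y) \<le> norm (grad_step x - grad_step y) + norm (\<gamma> *\<^sub>R grad \<phi>\<^sub>1 x - \<gamma> *\<^sub>R grad \<phi>\<^sub>1 y)"
    by (metis norm_triangle_ineq4)
  then show ?thesis
    using grad_step_perturbation[of x y] by (simp add: left_diff_distrib)
qed

lemma bounded_grad_step_image_iff: "bounded (grad_step ` A) \<longleftrightarrow> bounded A"
proof
  assume "bounded (grad_step ` A)"
  then obtain b where b: "\<And>x. x \<in> A \<Longrightarrow> norm (grad_step x) \<le> b"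
    by (auto simp: bounded_iff)
  have "norm x \<le> (b + norm (grad_step 0)) / (1 - \<gamma> * L)" if "x \<in> A" for x
    using grad_step_lower[of x 0] b[OF that] norm_triangle_ineq4[of "grad_step x" "grad_step 0"]
      gamma_L_less_1
    by (simp add: pos_le_divide_eq mult.commute)
  then show "bounded A" by (auto simp: bounded_iff)
next
  assume "bounded A"
  moreover have "(1 + \<gamma> * L)-lipschitz_on A grad_step"
    using grad_step_upper \<gamma>_pos lipschitz_on_nonneg[OF lip]
    by (auto simp: lipschitz_on_def dist_norm)
  ultimately show "bounded (grad_step ` A)"
    using bounded_uniformly_continuous_image lipschitz_on_uniformly_continuous by blast
qed

text \<open>Fermat's rule for the function that defines the proximal set.\<close>

lemma prox1_imp_grad_step:
  assumes "u \<in> prox1 s"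
  shows "s = grad_step u"
proof -
  define k where "k = 1 / (2 * \<gamma>)"
  define P where "P w = \<phi>\<^sub>1 w + k * ((w - s) \<bullet> (w - s))" for w
  have min: "P u \<le> P w" for w
    using assms
    by (simp add: prox_def argmin_def is_arg_min_linorder P_def k_def power2_norm_eq_inner)
  have "(\<phi>\<^sub>1 has_derivative (\<lambda>h. h \<bullet> grad \<phi>\<^sub>1 u)) (at u)"
    using GDERIV_grad[OF diff] by (simp add: gderiv_def)
  then have "(P has_derivative (\<lambda>h. h \<bullet> grad \<phi>\<^sub>1 u + k * ((u - s) \<bullet> h + h \<bullet> (u - s)))) (at u)"
    unfolding P_def[abs_def] by (auto intro!: derivative_eq_intros)
  moreover have "h \<bullet> grad \<phi>\<^sub>1 u + k * ((u - s) \<bullet> h + h \<bullet> (u - s)) =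
      h \<bullet> (grad \<phi>\<^sub>1 u + (1 / \<gamma>) *\<^sub>R (u - s))" for h
    by (simp add: k_def inner_add_right inner_commute[of "u - s"])
  ultimately have "(P has_derivative (\<lambda>h. h \<bullet> (grad \<phi>\<^sub>1 u + (1 / \<gamma>) *\<^sub>R (u - s)))) (at u)"
    by (simp only:)
  then have "(\<lambda>h. h \<bullet> (grad \<phi>\<^sub>1 u + (1 / \<gamma>) *\<^sub>R (u - s))) = (\<lambda>h. 0)"
    by (rule differential_zero_maxmin[OF UNIV_I open_UNIV]) (use min in auto)
  then have "grad \<phi>\<^sub>1 u + (1 / \<gamma>) *\<^sub>R (u - s) = 0"
    by (metis inner_eq_zero_iff)
  then have "\<gamma> *\<^sub>R (grad \<phi>\<^sub>1 u + (1 / \<gamma>) *\<^sub>R (u - s)) = 0"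
    by simp
  then have "\<gamma> *\<^sub>R grad \<phi>\<^sub>1 u + (u - s) = 0"
    using \<gamma>_pos by (simp only: scaleR_add_right scaleR_scaleR) simp
  then show ?thesis by (simp add: grad_step_def algebra_simps)
qed

text \<open>
  The proximal set at \<open>grad_step u\<close> consists of some \<open>v\<close> with \<open>grad_step v = grad_step u\<close>, and
  the lower distance estimate makes the gradient step injective.
\<close>

lemma prox1_grad_step: "prox1 (grad_step u) = {u}"
proof -
  obtain v where v: "prox1 (grad_step u) = {v}"
    using prox_singleton[OF diff lip \<gamma>_pos \<gamma>_less] by blast
  then have "grad_step u = grad_step v"
    by (intro prox1_imp_grad_step) simp
  then have "(1 - \<gamma> * L) * norm (u - v) \<le> 0"
    using grad_step_lower[of u v] by simp
  then have "u = v"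
    using gamma_L_less_1 by (auto simp: mult_le_0_iff)
  then show ?thesis using v by simp
qed

lemma surj_grad_step: "surj grad_step"
  unfolding surj_def
  using prox_singleton[OF diff lip \<gamma>_pos \<gamma>_less] prox1_imp_grad_step by (metis singletonI)

section \<open>The envelope between two values of the objective\<close>

text \<open>
  The linearisation of \<open>\<phi>\<^sub>1\<close> at \<open>u\<close> errs by at most \<open>L / 2\<close> times the squared distance, which the
  proximal term of the model more than compensates.
\<close>

lemma objective_le_dre_model:
  "objective w + ereal (modulus * (norm (w - u))\<^sup>2) \<le> dre_model \<gamma> \<phi>\<^sub>1 \<phi>\<^sub>2 u w"
proof -
  have "modulus * (norm (w - u))\<^sup>2 = 1 / (2 * \<gamma>) * (norm (w - u))\<^sup>2 - L / 2 * (norm (w - u))\<^sup>2"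
    by (simp add: modulus_def left_diff_distrib diff_divide_distrib)
  then have "\<phi>\<^sub>1 w + modulus * (norm (w - u))\<^sup>2
      \<le> \<phi>\<^sub>1 u + grad \<phi>\<^sub>1 u \<bullet> (w - u) + 1 / (2 * \<gamma>) * (norm (w - u))\<^sup>2"
    using lipschitz_grad_bound[OF diff lip, where v = u and w = w] unfolding abs_le_iff by linarith
  then show ?thesis
    unfolding dre_model_def by (cases "\<phi>\<^sub>2 w") (simp_all add: add.commute)
qed

lemma envelope_grad_step: "envelope (grad_step u) = (INF w. dre_model \<gamma> \<phi>\<^sub>1 \<phi>\<^sub>2 u w)"
  by (simp add: dre_def prox1_grad_step)

lemma envelope_le_objective: "envelope (grad_step u) \<le> objective u"
proof -
  have "envelope (grad_step u) \<le> dre_model \<gamma> \<phi>\<^sub>1 \<phi>\<^sub>2 u u"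
    unfolding envelope_grad_step by (rule INF_lower) simp
  then show ?thesis by (simp add: dre_model_def add.commute)
qed

lemma objective_le_envelope:
  obtains w where "objective w + ereal (modulus * (norm (w - u))\<^sup>2) \<le> envelope (grad_step u)"
proof -
  obtain w where "envelope (grad_step u) = dre_model \<gamma> \<phi>\<^sub>1 \<phi>\<^sub>2 u w"
    using dre_attained[OF diff lip proper lsc argmin_nonempty \<gamma>_pos \<gamma>_less, of u "grad_step u"]
    by (auto simp: prox1_grad_step)
  then show ?thesis using that objective_le_dre_model by metis
qed

lemma objective_minimum:
  "\<exists>m. (\<forall>x. ereal m \<le> objective x) \<and> argmin objective = {x. objective x = ereal m}"
proof -
  obtain z where z: "\<And>y. objective z \<le> objective y"
    using argmin_nonempty by (auto simp: argmin_def is_arg_min_linorder)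
  obtain w0 where w0: "\<phi>\<^sub>2 w0 \<noteq> \<infinity>" and np: "\<And>x. \<phi>\<^sub>2 x \<noteq> -\<infinity>"
    using proper by (auto simp: proper_def)
  obtain m where m: "objective z = ereal m"
    using z[of w0] w0 np[of w0] np[of z] by (cases "\<phi>\<^sub>2 z"; cases "\<phi>\<^sub>2 w0") auto
  show ?thesis
  proof (intro exI conjI allI)
    show low: "ereal m \<le> objective x" for x using z m by metis
    show "argmin objective = {x. objective x = ereal m}"
      unfolding argmin_def is_arg_min_linorder using low m by (metis (no_types, lifting) antisym)
  qed
qed

lemma minimum_le_envelope:
  assumes "\<And>x. ereal m \<le> objective x"
  shows "ereal m \<le> envelope s"
proof -
  obtain u where u: "s = grad_step u" using surj_grad_step by (metis surjD)
  obtain w where "objective w + ereal (modulus * (norm (w - u))\<^sup>2) \<le> envelope s"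
    unfolding u by (rule objective_le_envelope)
  moreover have "objective w \<le> objective w + ereal (modulus * (norm (w - u))\<^sup>2)"
    using modulus_pos by (intro ereal_le_add_self) simp
  ultimately show ?thesis using assms[of w] by (meson order_trans)
qed

section \<open>Infima, minimisers and sublevel sets\<close>

theorem INF_objective_eq_INF_envelope: "(INF x. objective x) = (INF s. envelope s)"
proof (rule antisym)
  obtain m where m: "\<And>x. ereal m \<le> objective x" "argmin objective = {x. objective x = ereal m}"
    using objective_minimum by blast
  then obtain z where "objective z = ereal m" using argmin_nonempty by auto
  then have "(INF x. objective x) \<le> ereal m"
    using INF_lower[of z UNIV objective] by simp
  also have "\<dots> \<le> (INF s. envelope s)"
    using minimum_le_envelope[OF m(1)] by (intro INF_greatest)
  finally show "(INF x. objective x) \<le> (INF s. envelope s)" .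
  show "(INF s. envelope s) \<le> (INF x. objective x)"
    using envelope_le_objective by (intro INF_mono) auto
qed

theorem argmin_objective_eq_prox1_argmin_envelope:
  "argmin objective = (\<Union>s\<in>argmin envelope. prox1 s)"
proof -
  obtain m where low: "\<And>x. ereal m \<le> objective x"
    and am: "argmin objective = {x. objective x = ereal m}"
    using objective_minimum by blast
  obtain z where z: "objective z = ereal m" using argmin_nonempty am by auto
  have env: "ereal m \<le> envelope s" for s by (rule minimum_le_envelope[OF low])
  have zenv: "envelope (grad_step z) = ereal m"
    using envelope_le_objective[of z] env[of "grad_step z"] z by simp
  have am_env: "argmin envelope = {s. envelope s = ereal m}"
    unfolding argmin_def is_arg_min_linorder using env zenv by (metis (no_types, lifting) antisym)
  have "objective u = ereal m \<longleftrightarrow> envelope (grad_step u) = ereal m" for u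
  proof
    assume "objective u = ereal m"
    then show "envelope (grad_step u) = ereal m"
      using envelope_le_objective[of u] env[of "grad_step u"] by simp
  next
    assume e: "envelope (grad_step u) = ereal m"
    obtain w where w: "objective w + ereal (modulus * (norm (w - u))\<^sup>2) \<le> ereal m"
      using e objective_le_envelope[of u] by metis
    \<comment> \<open>The objective is at least \<open>m\<close> at \<open>w\<close>, so nothing is left for the quadratic term.\<close>
    then have "modulus * (norm (w - u))\<^sup>2 \<le> 0"
      using low[of w] by (cases "objective w") auto
    then have "w = u" using modulus_pos by (simp add: mult_le_0_iff)
    then show "objective u = ereal m" using w low[of u] by simp
  qed
  then show ?thesis
    unfolding am am_env
    using prox1_grad_step prox1_imp_grad_step by (auto 4 3)
qed

text \<open>
  In the variable \<open>u\<close>, the sublevel set of the envelope contains that of \<open>\<phi>\<close> at the same height \<open>\<alpha>\<close>,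
  and each of its points \<open>u\<close> satisfies \<open>modulus \<cdot> \<parallel>w - u\<parallel>\<^sup>2 \<le> \<alpha> - min \<phi>\<close> for some \<open>w\<close> in the latter.
\<close>

theorem level_bounded_objective_iff: "level_bounded objective \<longleftrightarrow> level_bounded envelope"
proof -
  obtain m where low: "\<And>x. ereal m \<le> objective x"
    using objective_minimum by blast
  have pull: "{s. envelope s \<le> ereal \<alpha>} = grad_step ` {u. envelope (grad_step u) \<le> ereal \<alpha>}" for \<alpha>
    using surj_grad_step by (auto simp: surj_def)
  have "bounded {u. envelope (grad_step u) \<le> ereal \<alpha>} \<longleftrightarrow> bounded {x. objective x \<le> ereal \<alpha>}" for \<alpha>
  proof
    assume "bounded {u. envelope (grad_step u) \<le> ereal \<alpha>}"
    then show "bounded {x. objective x \<le> ereal \<alpha>}"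
      by (rule bounded_subset) (use envelope_le_objective order_trans in blast)
  next
    assume "bounded {x. objective x \<le> ereal \<alpha>}"
    then obtain b where b: "\<And>x. objective x \<le> ereal \<alpha> \<Longrightarrow> norm x \<le> b"
      by (auto simp: bounded_iff)
    have "norm u \<le> b + sqrt ((\<alpha> - m) / modulus)" if u: "envelope (grad_step u) \<le> ereal \<alpha>" for u
    proof -
      obtain w where w: "objective w + ereal (modulus * (norm (w - u))\<^sup>2) \<le> ereal \<alpha>"
        using u objective_le_envelope[of u] order_trans by metis
      have nonneg: "0 \<le> modulus * (norm (w - u))\<^sup>2" using modulus_pos by simp
      have "objective w \<le> ereal \<alpha>" and le: "modulus * (norm (w - u))\<^sup>2 \<le> \<alpha> - m"
        using w low[of w] nonneg by (cases "objective w"; simp)+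
      then have "norm w \<le> b" by (intro b)
      have "(norm (w - u))\<^sup>2 \<le> (\<alpha> - m) / modulus"
        using le modulus_pos by (simp add: pos_le_divide_eq mult.commute)
      then have "norm (w - u) \<le> sqrt ((\<alpha> - m) / modulus)" by (rule real_le_rsqrt)
      then show ?thesis
        using \<open>norm w \<le> b\<close> norm_triangle_ineq4[of w "w - u"] by simp
    qed
    then show "bounded {u. envelope (grad_step u) \<le> ereal \<alpha>}"
      by (auto simp: bounded_iff)
  qed
  then show ?thesis
    by (simp add: level_bounded_def pull bounded_grad_step_image_iff)
qed

end

theorem theorem3p4:
  fixes \<phi>\<^sub>1 :: "real ^ 'p \<Rightarrow> real"
    and \<phi>\<^sub>2 \<phi> :: "real ^ 'p \<Rightarrow> ereal"
    and L \<gamma> :: real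
  defines "\<phi> \<equiv> \<lambda>x. ereal (\<phi>\<^sub>1 x) + \<phi>\<^sub>2 x"
  assumes "\<And>x. \<phi>\<^sub>1 differentiable (at x)"
    and "L-lipschitz_on UNIV (grad \<phi>\<^sub>1)"
    and "proper \<phi>\<^sub>2"
    and "lower_semicontinuous \<phi>\<^sub>2"
    and "argmin \<phi> \<noteq> {}"
    and "0 < \<gamma>" and "ereal \<gamma> < 1 / ereal L"
  shows "((INF x. \<phi> x) = (INF s. dre \<gamma> \<phi>\<^sub>1 \<phi>\<^sub>2 s)) \<and>
    argmin \<phi> = (\<Union>s\<in>argmin (dre \<gamma> \<phi>\<^sub>1 \<phi>\<^sub>2). prox \<gamma> (\<lambda>x. ereal (\<phi>\<^sub>1 x)) s) \<and>
    (level_bounded \<phi> \<longleftrightarrow> level_bounded (dre \<gamma> \<phi>\<^sub>1 \<phi>\<^sub>2))"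
proof -
  interpret dr_splitting \<phi>\<^sub>1 \<phi>\<^sub>2 L \<gamma>
    using assms(2-) unfolding \<phi>_def by unfold_locales
  show ?thesis
    unfolding \<phi>_def
    using INF_objective_eq_INF_envelope argmin_objective_eq_prox1_argmin_envelope
      level_bounded_objective_iff
    by blast
qed

end
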